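(* Let $d>0$, $\beta\ge0$, $\alpha\ge1$, $\tau>0$, and let the triangulation $\mathcal K_h$ satisfy the angle condition $\alpha_1+\alpha_2\le\pi$ for every edge. Let $(\xi^n)_{n\ge0}\subset\mathbb R^N$ be defined by $$\xi^{n+1}=(\bar M+d\tau A)^{-1}\bar M\big(\xi^n-\tau\beta(\xi^n)^\alpha\big),\qquad n\in\mathbb N\cup\{0\},$$ with initial data $\xi^0\in\mathbb R^N$ having nonnegative components, and let $U^0=\sum_{i=1}^N\xi^0_i\chi_i$. If the time step satisfies $$\beta\tau\le\Big(\max_{y\in\Gamma_h}U^0(y)\Big)^{1-\alpha},$$ then $$0\le\xi_i^n\le\max_{j=1,\dots,N}\xi^0_j\qquad\forall\,i=1,\dots,N,\ \forall\,n\in\mathbb N.$$ In particular, for $\beta=0$ the conclusion holds with no restriction on $\tau$.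
   Context: $\Gamma\subset\mathbb R^3$ is a compact, orientable, smooth surface without boundary, given as the zero level set of a sufficiently smooth signed distance function $\mathsf d$ defined on an open neighbourhood $W$ of $\Gamma$ with $\nabla\mathsf d\neq 0$ on $W$; its unit normal is $\nu=\nabla \mathsf d/|\nabla\mathsf d|$, and every $x\in W$ is uniquely written as $x=a(x)+\mathsf d(x)\nu(a(x))$ with $a(x)\in\Gamma$. For $h>0$, $\Gamma_h=\bigcup_{K\in\mathcal K_h}K\subset W$ is a closed triangulated surface, where $\mathcal K_h$ is a finite (conforming) set of non-degenerate triangles with diameters at most $h$, whose vertices $x_1,\dots,x_N$ lie on $\Gamma$, and such that $a|_{\Gamma_h}$ is a one-to-one map between $\Gamma_h$ and $\Gamma$. $S_h$ is the space of continuous functions on $\Gamma_h$ that are affine on each $K\in\mathcal K_h$, with nodal basis $\chi_1,\dots,\chi_N$, $\chi_i(x_j)=\delta_{ij}$. For continuous $v$ on $\Gamma_h$, $I_h(v)=\sum_i v(x_i)\chi_i$. $\nabla_{\Gamma_h}$ is the (trianglewise) tangential gradient. Lumped mass matrix: $\bar M=(\bar m_{ij})$, $\bar m_{ij}=\int_{\Gamma_h}I_h(\chi_i\chi_j)$. Stiffness matrix: $A=(a_{ij})$, $a_{ij}=\int_{\Gamma_h}\nabla_{\Gamma_h}\chi_i\cdot\nabla_{\Gamma_h}\chi_j$. Powers of vectors are componentwise. Angle condition: for every edge $e$ of $\mathcal K_h$, if $K_1,K_2$ are the two triangles sharing $e$ and $\alpha_1,\alpha_2$ are the angles of $K_1,K_2$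 opposite to $e$, then $\alpha_1+\alpha_2\le\pi$. If $\max U^0=0$ and $\alpha>1$, the right-hand side of the time step condition is read as $+\infty$. *)

theory Defs
  imports "HOL-Analysis.Analysis"
begin

primrec C_k_on :: "nat \<Rightarrow> ('a::real_normed_vector \<Rightarrow> 'b::real_normed_vector) \<Rightarrow> 'a set \<Rightarrow> bool" where
  "C_k_on 0 f S \<longleftrightarrow> continuous_on S f"
| "C_k_on (Suc k) f S \<longleftrightarrow>
     (\<forall>x\<in>S. f differentiable (at x)) \<and>
     (\<forall>v. C_k_on k (\<lambda>x. frechet_derivative f (at x) v) S)"

definition gradient :: "('a::real_inner \<Rightarrow> real) \<Rightarrow> 'a \<Rightarrow> 'a" where
  "gradient f x = (THE g. GDERIV f x :> g)"

definition unit_normal :: "(real^3 \<Rightarrow> real) \<Rightarrow> real^3 \<Rightarrow> real^3" where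
  "unit_normal f x = (1 / norm (gradient f x)) *\<^sub>R gradient f x"

text \<open>Either sign convention (negative inside or negative outside) is allowed.\<close>

definition signed_distance_on :: "(real^3) set \<Rightarrow> (real^3) set \<Rightarrow> (real^3 \<Rightarrow> real) \<Rightarrow> bool" where
  "signed_distance_on W \<Gamma> \<delta> \<longleftrightarrow>
     (\<forall>x\<in>W. \<bar>\<delta> x\<bar> = infdist x \<Gamma>) \<and>
     \<Gamma> \<subseteq> closure {x\<in>W. \<delta> x > 0} \<and> \<Gamma> \<subseteq> closure {x\<in>W. \<delta> x < 0}"

text \<open>A compact level set of a \<open>C\<^sup>2\<close> function on an open set, at which the gradient does not
  vanish, is an embedded surface without boundary; the continuous field \<open>unit_normal \<delta>\<close>
  orients it.\<close>

definition level_surface :: "(real^3) set \<Rightarrow> (real^3) set \<Rightarrow> (real^3 \<Rightarrow> real) \<Rightarrow> bool" where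
  "level_surface \<Gamma> W \<delta> \<longleftrightarrow>
     compact \<Gamma> \<and> open W \<and> \<Gamma> = {x\<in>W. \<delta> x = 0} \<and>
     signed_distance_on W \<Gamma> \<delta> \<and> C_k_on 2 \<delta> W \<and> (\<forall>x\<in>W. gradient \<delta> x \<noteq> 0) \<and>
     (\<forall>x\<in>W. \<exists>!p. p \<in> \<Gamma> \<and> x = p + \<delta> x *\<^sub>R unit_normal \<delta> p)"

definition surface_projection :: "(real^3) set \<Rightarrow> (real^3 \<Rightarrow> real) \<Rightarrow> real^3 \<Rightarrow> real^3" where
  "surface_projection \<Gamma> \<delta> x = (THE p. p \<in> \<Gamma> \<and> x = p + \<delta> x *\<^sub>R unit_normal \<delta> p)"

text \<open>\<open>triangulation\<close> is the conformity condition: two triangles meet in a common face, possibly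
  empty.  Since \<open>2 simplex K\<close> means that \<open>K\<close> is non-degenerate, whenever
  \<open>convex hull {p, q, r} \<in> \<K>\<close> the points \<open>p\<close>, \<open>q\<close>, \<open>r\<close> are the three distinct vertices of this
  triangle and \<open>{p, q}\<close> spans one of its edges.\<close>

definition closed_triangulated_surface :: "(real^3) set set \<Rightarrow> bool" where
  "closed_triangulated_surface \<K> \<longleftrightarrow>
     triangulation \<K> \<and> (\<forall>K\<in>\<K>. 2 simplex K) \<and>
     (\<forall>p q r. convex hull {p, q, r} \<in> \<K> \<longrightarrow>
        card {K\<in>\<K>. \<exists>s. K = convex hull {p, q, s}} = 2) \<and>
     (\<forall>y\<in>\<Union>\<K>. \<exists>U. openin (top_of_set (\<Union>\<K>)) U \<and> y \<in> U \<and>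
        U homeomorphic (UNIV :: (real^2) set))"

definition vertices :: "(real^3) set set \<Rightarrow> (real^3) set" where
  "vertices \<K> = {v. \<exists>K\<in>\<K>. v extreme_point_of K}"

definition angle_at :: "real^3 \<Rightarrow> real^3 \<Rightarrow> real^3 \<Rightarrow> real" where
  "angle_at r p q = arccos (((p - r) \<bullet> (q - r)) / (norm (p - r) * norm (q - r)))"

definition angle_condition :: "(real^3) set set \<Rightarrow> bool" where
  "angle_condition \<K> \<longleftrightarrow>
     (\<forall>p q r s. convex hull {p, q, r} \<in> \<K> \<longrightarrow> convex hull {p, q, s} \<in> \<K> \<longrightarrow>
        convex hull {p, q, r} \<noteq> convex hull {p, q, s} \<longrightarrow>
        angle_at r p q + angle_at s p q \<le> pi)"

text \<open>Functions on \<open>\<Union>\<K>\<close> are represented by total functions; their values elsewhere never matter.\<close>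

definition fe_space :: "(real^3) set set \<Rightarrow> (real^3 \<Rightarrow> real) set" where
  "fe_space \<K> =
     {f. continuous_on (\<Union>\<K>) f \<and> (\<forall>K\<in>\<K>. \<exists>g c. \<forall>y\<in>K. f y = g \<bullet> y + c)}"

definition nodal_basis ::
    "(real^3) set set \<Rightarrow> ('n \<Rightarrow> real^3) \<Rightarrow> ('n \<Rightarrow> real^3 \<Rightarrow> real) \<Rightarrow> bool" where
  "nodal_basis \<K> x \<phi> \<longleftrightarrow>
     (\<forall>i. \<phi> i \<in> fe_space \<K>) \<and> (\<forall>i j. \<phi> i (x j) = (if i = j then 1 else 0))"

definition interpolant ::
    "('n::finite \<Rightarrow> real^3) \<Rightarrow> ('n \<Rightarrow> real^3 \<Rightarrow> real) \<Rightarrow> (real^3 \<Rightarrow> real) \<Rightarrow> real^3 \<Rightarrow> real" where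
  "interpolant x \<phi> v y = (\<Sum>i\<in>UNIV. v (x i) * \<phi> i y)"

text \<open>The surface integral over a triangle, by the affine parametrisation
  \<open>(s, t) \<mapsto> p + s (q - p) + t (r - p)\<close> with area element \<open>\<bar>(q - p) \<times> (r - p)\<bar> ds dt\<close>.
  Its value does not depend on how the vertices are enumerated.\<close>

definition triangle_integral :: "(real^3) set \<Rightarrow> (real^3 \<Rightarrow> real) \<Rightarrow> real" where
  "triangle_integral K f =
     (let (p, q, r) = (SOME (p, q, r). K = convex hull {p, q, r})
      in norm (cross3 (q - p) (r - p)) *
           integral {(s, t). 0 \<le> s \<and> 0 \<le> t \<and> s + t \<le> 1}
             (\<lambda>(s, t). f (p + s *\<^sub>R (q - p) + t *\<^sub>R (r - p))))"

text \<open>The gradient of \<open>f\<close> restricted to the triangle \<open>K\<close>, as a vector tangent to \<open>K\<close>.\<close>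

definition tangential_gradient :: "(real^3) set \<Rightarrow> (real^3 \<Rightarrow> real) \<Rightarrow> real^3 \<Rightarrow> real^3" where
  "tangential_gradient K f y =
     (THE g. g \<in> span ((\<lambda>z. z - y) ` K) \<and> (f has_derivative (\<lambda>v. v \<bullet> g)) (at y within K))"

text \<open>Integrals over \<open>\<Union>\<K>\<close> are sums over the triangles, which overlap only in null sets.\<close>

definition lumped_mass_matrix ::
    "(real^3) set set \<Rightarrow> ('n::finite \<Rightarrow> real^3) \<Rightarrow> ('n \<Rightarrow> real^3 \<Rightarrow> real) \<Rightarrow> real^'n^'n" where
  "lumped_mass_matrix \<K> x \<phi> =
     (\<chi> i j. \<Sum>K\<in>\<K>. triangle_integral K (interpolant x \<phi> (\<lambda>y. \<phi> i y * \<phi> j y)))"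

definition stiffness_matrix ::
    "(real^3) set set \<Rightarrow> ('n::finite \<Rightarrow> real^3 \<Rightarrow> real) \<Rightarrow> real^'n^'n" where
  "stiffness_matrix \<K> \<phi> =
     (\<chi> i j. \<Sum>K\<in>\<K>. triangle_integral K
        (\<lambda>y. tangential_gradient K (\<phi> i) y \<bullet> tangential_gradient K (\<phi> j) y))"

definition cpow :: "real^'n \<Rightarrow> real \<Rightarrow> real^'n" where
  "cpow v \<alpha> = (\<chi> i. v $ i powr \<alpha>)"

text \<open>\<open>m\<^bsup>1 - \<alpha>\<^esup>\<close> for \<open>m \<ge> 0\<close> and \<open>\<alpha> \<ge> 1\<close>, with \<open>0\<^bsup>1 - \<alpha>\<^esup> = \<infinity>\<close> for \<open>\<alpha> > 1\<close>.  The case \<open>\<alpha> = 1\<close> is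
  separate because \<open>0 powr 0 = 0\<close>, whereas here \<open>0\<^bsup>0\<^esup> = 1\<close>.\<close>

definition time_step_bound :: "real \<Rightarrow> real \<Rightarrow> ereal" where
  "time_step_bound m \<alpha> =
     (if \<alpha> = 1 then 1 else if m = 0 then \<infinity> else ereal (m powr (1 - \<alpha>)))"

end

theory Submission
  imports Defs
begin

text \<open>One time step consists of an explicit reaction step
  \<open>u\<^sub>i = \<xi>\<^sub>i - \<tau>\<beta> \<xi>\<^sub>i\<^sup>\<alpha>\<close> followed by an implicit diffusion step, which solves
  \<open>(M + d\<tau> A) w = M u\<close>.  Both map vectors with entries in \<open>[0, m]\<close>, where \<open>m\<close> is the maximum of the
  initial data, to vectors of the same kind; induction over the time steps then gives the theorem.

  For the reaction step, if \<open>\<xi>\<^sub>i > 0\<close> then \<open>u\<^sub>i = \<xi>\<^sub>i (1 - \<tau>\<beta> \<xi>\<^sub>i\<^bsup>\<alpha>-1\<^esup>)\<close>, and the time step condition makes the factor in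
  brackets lie in \<open>[0, 1]\<close> as long as \<open>\<xi>\<^sub>i \<le> m\<close> (\<open>reaction_step_bounds\<close>, \<open>step_factor_le_1\<close>).  The
  maximum of \<open>U\<^sup>0\<close> is at least \<open>m\<close> because \<open>U\<^sup>0\<close> takes the value \<open>\<xi>\<^sup>0\<^sub>j\<close> at the node \<open>x\<^sub>j\<close>.

  For the diffusion step, a discrete maximum principle holds (\<open>discrete_min_principle\<close>): the lumped
  mass matrix \<open>M\<close> is diagonal with positive diagonal, the rows of \<open>A\<close> sum to zero, and the
  off-diagonal entries of \<open>A\<close> are nonpositive.  At an index \<open>k\<close> where \<open>w\<close> is minimal this gives
  \<open>(A w)\<^sub>k \<le> 0\<close>, hence \<open>w\<^sub>k \<ge> u\<^sub>k\<close>; the same argument for \<open>-w\<close> bounds the maximum, and for zero data it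
  shows that the system matrix is invertible.

  The geometry enters only through these three properties of the matrices.  Mass lumping replaces \<open>\<phi>\<^sub>i \<phi>\<^sub>j\<close> by
  \<open>\<delta>\<^sub>i\<^sub>j \<phi>\<^sub>i\<close>, so that \<open>M\<close> is diagonal with the integrals of the hat functions on the diagonal.  The
  hat functions sum to 1 at the corners of each triangle, so their gradients sum to 0 and \<open>A\<close> has zero
  row sums.  For \<open>i \<noteq> j\<close> a triangle contributes to \<open>A\<^sub>i\<^sub>j\<close> only if it has the edge \<open>x\<^sub>i x\<^sub>j\<close>, and then it
  contributes a negative multiple, the same for all triangles, of the cotangent of the angle opposite
  to that edge (\<open>hat_gradients_cot\<close>).  An edge lies in exactly two triangles, and for their angles
  \<open>\<alpha>\<^sub>1 + \<alpha>\<^sub>2 \<le> \<pi>\<close> implies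
  \<open>cot \<alpha>\<^sub>1 + cot \<alpha>\<^sub>2 = sin (\<alpha>\<^sub>1 + \<alpha>\<^sub>2) / (sin \<alpha>\<^sub>1 sin \<alpha>\<^sub>2) \<ge> 0\<close>.\<close>

section \<open>The reaction step and the discrete maximum principle\<close>

text \<open>At an index \<open>k\<close> where \<open>w\<close> is minimal the zero row sums turn row \<open>k\<close> of \<open>A w\<close> into
  \<open>\<Sum>\<^sub>j A\<^sub>k\<^sub>j (w\<^sub>j - w\<^sub>k)\<close>, a sum of nonpositive terms; so \<open>w\<close> cannot be smaller there than \<open>u\<close>.\<close>

lemma discrete_min_principle:
  fixes M A :: "real^'n^'n" and u w :: "real^'n"
  assumes M_offdiag: "\<And>i j. i \<noteq> j \<Longrightarrow> M $ i $ j = 0" and M_diag: "\<And>i. M $ i $ i > 0"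
    and A_offdiag: "\<And>i j. i \<noteq> j \<Longrightarrow> A $ i $ j \<le> 0" and A_rows: "\<And>i. (\<Sum>j\<in>UNIV. A $ i $ j) = 0"
    and c: "c \<ge> 0" and eq: "(M + c *\<^sub>R A) *v w = M *v u" and u: "\<And>i. a \<le> u $ i"
  shows "a \<le> w $ i"
proof -
  have "Min (range (\<lambda>j. w $ j)) \<in> range (\<lambda>j. w $ j)"
    by (rule Min_in) auto
  then obtain k where "Min (range (\<lambda>j. w $ j)) = w $ k"
    by (rule imageE)
  moreover have "Min (range (\<lambda>j. w $ j)) \<le> w $ j" for j
    by (rule Min_le) auto
  ultimately have k: "w $ k \<le> w $ j" for j
    by metis
  have Mv: "(M *v v) $ k = M $ k $ k * v $ k" for v
  proof -
    have "(M *v v) $ k = (\<Sum>j\<in>UNIV. if j = k then M $ k $ k * v $ k else 0)"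
      unfolding matrix_vector_mult_def vec_lambda_beta
      by (rule sum.cong) (auto simp: M_offdiag)
    then show ?thesis by simp
  qed
  have "(A *v w) $ k = (\<Sum>j\<in>UNIV. A $ k $ j * w $ j) - (\<Sum>j\<in>UNIV. A $ k $ j) * w $ k"
    by (simp add: matrix_vector_mult_def A_rows)
  also have "\<dots> = (\<Sum>j\<in>UNIV. A $ k $ j * (w $ j - w $ k))"
    by (simp add: sum_distrib_right sum_subtractf right_diff_distrib)
  also have "\<dots> \<le> 0"
  proof (rule sum_nonpos)
    fix j show "A $ k $ j * (w $ j - w $ k) \<le> 0"
      using A_offdiag[of k j] k[of j] by (cases "j = k") (auto simp: mult_le_0_iff)
  qed
  finally have "c * (A *v w) $ k \<le> 0"
    using c by (simp add: mult_le_0_iff)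
  moreover have "((M + c *\<^sub>R A) *v w) $ k = M $ k $ k * w $ k + c * (A *v w) $ k"
    by (simp add: matrix_vector_mult_add_rdistrib scaleR_matrix_vector_assoc[symmetric] Mv)
  ultimately have "M $ k $ k * u $ k \<le> M $ k $ k * w $ k"
    using eq Mv by simp
  then have "u $ k \<le> w $ k"
    using M_diag[of k] by simp
  then show ?thesis
    using u[of k] k[of i] by simp
qed

text \<open>The minimum principle for \<open>w\<close> and \<open>-w\<close> with zero data gives a trivial kernel, so that
  \<open>matrix_inv\<close> is a genuine inverse; for \<open>w\<close> with data \<open>u\<close> and for \<open>-w\<close> with data \<open>-u\<close> it gives the two
  bounds.\<close>

lemma implicit_step_bounds:
  fixes M A :: "real^'n^'n" and u :: "real^'n"
  assumes M_offdiag: "\<And>i j. i \<noteq> j \<Longrightarrow> M $ i $ j = 0" and M_diag: "\<And>i. M $ i $ i > 0"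
    and A_offdiag: "\<And>i j. i \<noteq> j \<Longrightarrow> A $ i $ j \<le> 0" and A_rows: "\<And>i. (\<Sum>j\<in>UNIV. A $ i $ j) = 0"
    and c: "c \<ge> 0" and u: "\<And>i. a \<le> u $ i" "\<And>i. u $ i \<le> b"
  shows "a \<le> (matrix_inv (M + c *\<^sub>R A) *v (M *v u)) $ i"
    and "(matrix_inv (M + c *\<^sub>R A) *v (M *v u)) $ i \<le> b"
proof -
  let ?B = "M + c *\<^sub>R A"
  have min: "a \<le> w $ i" if "?B *v w = M *v u" "\<And>i. a \<le> u $ i" for a u w i
    by (rule discrete_min_principle[of M A c w u]) (fact M_offdiag M_diag A_offdiag A_rows c that)+
  have neg: "N *v (- v) = - (N *v v)" for N :: "real^'n^'n" and v
    by (simp add: vec_eq_iff matrix_vector_mult_def sum_negf)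
  have "w = 0" if w: "?B *v w = 0" for w
  proof -
    have "0 \<le> w $ i" for i
      by (rule min[where u = 0]) (simp_all add: w)
    moreover have "0 \<le> (- w) $ i" for i
      by (rule min[where u = 0]) (simp_all add: neg w )
    ultimately show ?thesis
      unfolding vec_eq_iff by (auto intro!: order_antisym)
  qed
  then have "invertible ?B"
    using matrix_left_invertible_ker[of ?B] by (simp add: invertible_left_inverse)
  then have "?B ** matrix_inv ?B = mat 1"
    unfolding invertible_def matrix_inv_def by (rule someI_ex[THEN conjunct1])
  then have w: "?B *v (matrix_inv ?B *v (M *v u)) = M *v u"
    by (metis matrix_vector_mul_assoc matrix_vector_mul_lid)
  show "a \<le> (matrix_inv ?B *v (M *v u)) $ i"
    by (rule min[OF w u(1)])
  have "- b \<le> (- (matrix_inv ?B *v (M *v u))) $ i"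
    by (rule min[where u = "- u"]) (simp_all only: neg w u vector_uminus_component neg_le_iff_le)
  then show "(matrix_inv ?B *v (M *v u)) $ i \<le> b"
    by simp
qed

text \<open>For \<open>v > 0\<close> the new value is \<open>v (1 - b v\<^bsup>\<alpha>-1\<^esup>)\<close>, and \<open>b v\<^bsup>\<alpha>-1\<^esup> \<le> b m\<^bsup>\<alpha>-1\<^esup> \<le> 1\<close> because
  \<open>\<alpha> \<ge> 1\<close>.  The step condition is required for \<open>m > 0\<close> only, since \<open>m = 0\<close> forces \<open>v = 0\<close>.\<close>

lemma reaction_step_bounds:
  fixes v m b \<alpha> :: real
  assumes v: "0 \<le> v" "v \<le> m" and b: "b \<ge> 0" and \<alpha>: "\<alpha> \<ge> 1"
    and step: "m > 0 \<Longrightarrow> b * m powr (\<alpha> - 1) \<le> 1"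
  shows "0 \<le> v - b * v powr \<alpha>" "v - b * v powr \<alpha> \<le> m"
proof -
  show "v - b * v powr \<alpha> \<le> m"
    using v mult_nonneg_nonneg[OF b powr_ge_zero[of v \<alpha>]] by linarith
  show "0 \<le> v - b * v powr \<alpha>"
  proof (cases "v = 0")
    case False
    then have "v > 0" using v by simp
    then have "b * v powr (\<alpha> - 1) \<le> b * m powr (\<alpha> - 1)"
      using v b \<alpha> by (intro mult_left_mono powr_mono2) auto
    also have "\<dots> \<le> 1"
      using \<open>v > 0\<close> v(2) by (intro step) simp
    finally have "b * v powr (\<alpha> - 1) \<le> 1" .
    then have "v * (b * v powr (\<alpha> - 1)) \<le> v * 1"
      using v by (intro mult_left_mono)
    moreover have "v * v powr (\<alpha> - 1) = v powr \<alpha>"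
      using \<open>v > 0\<close> by (metis add.commute diff_add_cancel powr_add powr_one less_imp_le)
    ultimately show ?thesis by (simp add: mult.left_commute)
  qed simp
qed

text \<open>The bound decreases with the maximum in it, so a bound in terms of \<open>S\<close> implies the one in
  terms of any positive \<open>m \<le> S\<close>.\<close>

lemma step_factor_le_1:
  assumes "0 < m" "m \<le> S" "\<alpha> \<ge> 1" and "ereal b \<le> time_step_bound S \<alpha>"
  shows "b * m powr (\<alpha> - 1) \<le> 1"
proof (cases "\<alpha> = 1")
  case True
  then show ?thesis using assms by (simp add: time_step_bound_def one_ereal_def)
next
  case False
  have "b \<le> S powr (1 - \<alpha>)"
    using assms False by (simp add: time_step_bound_def)
  also have "\<dots> \<le> m powr (1 - \<alpha>)"
    using assms by (intro powr_mono2') auto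
  finally have "b * m powr (\<alpha> - 1) \<le> m powr (1 - \<alpha>) * m powr (\<alpha> - 1)"
    by (intro mult_right_mono) auto
  also have "\<dots> = 1"
    using assms by (simp add: powr_add[symmetric])
  finally show ?thesis .
qed

section \<open>Integrals over a triangle\<close>

lemma simplex2_obtain:
  assumes "2 simplex K"
  obtains p q r where "K = convex hull {p, q, r}" "\<not> collinear {p, q, r}"
proof -
  obtain C where C: "\<not> affine_dependent C" "int (card C) = 3" "K = convex hull C"
    using assms by (auto simp: simplex_def)
  then obtain p q r where pqr: "C = {p, q, r}" "p \<noteq> q" "q \<noteq> r" "p \<noteq> r"
    by (metis card_3_iff of_nat_eq_iff of_nat_numeral)
  show thesis
    by (rule that[of p q r]) (use C pqr in \<open>auto simp: collinear_3_eq_affine_dependent\<close>)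
qed

lemma not_collinear_simplex2:
  fixes p q r :: "'a::euclidean_space"
  assumes "2 simplex (convex hull {p, q, r})"
  shows "\<not> collinear {p, q, r}"
proof -
  have "aff_dim {p, q, r} = 2"
    using aff_dim_simplex[OF assms] by (simp add: aff_dim_convex_hull)
  then show ?thesis by (simp add: collinear_aff_dim)
qed

lemma extreme_points_triangle:
  fixes p q r :: "'a::euclidean_space"
  assumes "\<not> collinear {p, q, r}"
  shows "{v. v extreme_point_of (convex hull {p, q, r})} = {p, q, r}"
proof -
  have "\<not> affine_dependent {p, q, r}"
    using assms unfolding collinear_3_eq_affine_dependent by blast
  from extreme_point_of_convex_hull_affine_independent[OF this] show ?thesis
    by blast
qed

text \<open>The corners are the extreme points of the triangle.\<close>

lemma triangle_vertices_unique:
  fixes p q r :: "'a::euclidean_space"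
  assumes "convex hull {p, q, r} = convex hull {p', q', r'}" "\<not> collinear {p, q, r}"
  shows "{p', q', r'} = {p, q, r}"
proof -
  have "aff_dim {p', q', r'} = aff_dim {p, q, r}"
    by (metis assms(1) aff_dim_convex_hull)
  then have "\<not> collinear {p', q', r'}"
    using assms(2) by (simp add: collinear_aff_dim)
  then show ?thesis
    using extreme_points_triangle assms by metis
qed

text \<open>Twice the area of a triangle does not depend on the order of its corners, since
  \<open>(b - a) \<times> (c - a) = a \<times> b + b \<times> c + c \<times> a\<close> only changes its sign when corners are exchanged.\<close>

lemma norm_cross3_permute:
  fixes p q r :: "real^3"
  assumes "{p', q', r'} = {p, q, r}" "p \<noteq> q" "q \<noteq> r" "p \<noteq> r"
  shows "norm (cross3 (q' - p') (r' - p')) = norm (cross3 (p - r) (q - r))"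
proof -
  define N where "N a b c = norm (cross3 (b - a) (c - a))" for a b c :: "real^3"
  have cyclic: "cross3 (b - a) (c - a) = cross3 a b + cross3 b c + cross3 c a" for a b c
    using cross_skew[of b a] cross_skew[of a c]
    by (simp add: Cross3.left_diff_distrib Cross3.right_diff_distrib)
  have swap: "cross3 (b - a) (c - a) = - cross3 (a - b) (c - b)" for a b c
    using cross_skew[of a b] cross_skew[of b c] cross_skew[of c a] by (simp add: cyclic)
  have sw1: "N a b c = N b a c" for a b c
    unfolding N_def swap[of b a c] by simp
  have sw2: "N a b c = N a c b" for a b c
    unfolding N_def cross_skew[of "b - a"] by simp
  have "(p' = p \<and> q' = q \<and> r' = r) \<or> (p' = p \<and> q' = r \<and> r' = q) \<or> (p' = q \<and> q' = p \<and> r' = r) \<or>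
        (p' = q \<and> q' = r \<and> r' = p) \<or> (p' = r \<and> q' = p \<and> r' = q) \<or> (p' = r \<and> q' = q \<and> r' = p)"
  proof -
    have "p' \<in> {p, q, r}" "q' \<in> {p, q, r}" "r' \<in> {p, q, r}"
      "p \<in> {p', q', r'}" "q \<in> {p', q', r'}" "r \<in> {p', q', r'}"
      using assms(1) by blast+
    then show ?thesis using assms(2-4) by auto
  qed
  then have "N p' q' r' = N r p q"
    using sw1 sw2 by metis
  then show ?thesis by (simp add: N_def)
qed

definition ref_triangle :: "(real \<times> real) set" where
  "ref_triangle = {(s, t). 0 \<le> s \<and> 0 \<le> t \<and> s + t \<le> 1}"

lemma affine_par_in_triangle:
  assumes "(s, t) \<in> ref_triangle"
  shows "p + s *\<^sub>R (q - p) + t *\<^sub>R (r - p) \<in> convex hull {p, q, r}"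
  using assms unfolding convex_hull_3_alt ref_triangle_def by blast

lemma compact_ref_triangle: "compact ref_triangle"
proof -
  have "bounded ref_triangle"
    by (rule bounded_subset[OF bounded_cbox[of "(0, 0)" "(1, 1)"]])
       (auto simp: ref_triangle_def cbox_Pair_eq)
  moreover have "closed ref_triangle"
    unfolding ref_triangle_def case_prod_beta
    by (intro closed_Collect_conj closed_Collect_le continuous_intros)
  ultimately show ?thesis
    by (simp add: compact_eq_bounded_closed)
qed

text \<open>\<open>triangle_integral\<close> uses a chosen enumeration of the corners.  It is a permutation of any
  given one, and the area factor can be expressed in the given one.\<close>

lemma triangle_integral_enum:
  assumes "K = convex hull {p, q, r}" "\<not> collinear {p, q, r}"
  obtains p' q' r' where "{p', q', r'} = {p, q, r}"
    "\<And>f. triangle_integral K f = norm (cross3 (p - r) (q - r)) *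
       integral ref_triangle (\<lambda>(s, t). f (p' + s *\<^sub>R (q' - p') + t *\<^sub>R (r' - p')))"
proof -
  obtain p' q' r' where some: "(SOME (p, q, r). K = convex hull {p, q, r}) = (p', q', r')"
    by (metis prod_cases3)
  have K: "K = convex hull {p', q', r'}"
    using someI[of "\<lambda>(p, q, r). K = convex hull {p, q, r}" "(p, q, r)"] assms(1)
    unfolding some by simp
  have perm: "{p', q', r'} = {p, q, r}"
    using triangle_vertices_unique K assms by metis
  have "p \<noteq> q" "q \<noteq> r" "p \<noteq> r"
    using assms(2) by (auto simp: collinear_3_eq_affine_dependent)
  from norm_cross3_permute[OF perm this]
  show thesis
    by (intro that[of p' q' r', OF perm])
       (simp add: triangle_integral_def some ref_triangle_def)
qed

lemma triangle_integral_const: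
  assumes "K = convex hull {p, q, r}" "\<not> collinear {p, q, r}" "\<And>y. y \<in> K \<Longrightarrow> f y = c"
  shows "triangle_integral K f =
    c * norm (cross3 (p - r) (q - r)) * integral ref_triangle (\<lambda>_. 1)"
proof -
  obtain p' q' r' where perm: "{p', q', r'} = {p, q, r}"
    and *: "triangle_integral K f = norm (cross3 (p - r) (q - r)) *
       integral ref_triangle (\<lambda>(s, t). f (p' + s *\<^sub>R (q' - p') + t *\<^sub>R (r' - p')))"
    using triangle_integral_enum[OF assms(1,2)] by metis
  have "integral ref_triangle (\<lambda>(s, t). f (p' + s *\<^sub>R (q' - p') + t *\<^sub>R (r' - p')))
      = integral ref_triangle (\<lambda>_. c * 1)"
    by (rule integral_cong)
       (use affine_par_in_triangle[of _ _ p' q' r'] perm assms in auto)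
  then show ?thesis
    by (simp only: * integral_mult_right) simp
qed

lemma integral_ref_triangle_nonneg: "integral ref_triangle (\<lambda>_. 1 :: real) \<ge> 0"
proof (rule integral_nonneg)
  show "(\<lambda>_. 1 :: real) integrable_on ref_triangle"
    using lmeasurable_compact[OF compact_ref_triangle] lmeasurable_iff_integrable_on by blast
qed simp

text \<open>A crude substitute for the exact value, which is the area times the mean of the three corner
  values: it suffices that the integral of a hat function is positive on a triangle at its node.  On
  the square \<open>[1/4, 1/3]\<^sup>2\<close> inside the reference triangle all barycentric coordinates are at least
  \<open>1/4\<close>, so \<open>f\<close> is at least a quarter of the sum of its corner values there; the square has area
  \<open>1/144\<close>.\<close>

lemma triangle_integral_affine_ge:
  assumes K: "K = convex hull {p, q, r}" "\<not> collinear {p, q, r}"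
    and f: "\<And>y. y \<in> K \<Longrightarrow> f y = g \<bullet> y + c" and nonneg: "f p \<ge> 0" "f q \<ge> 0" "f r \<ge> 0"
  shows "triangle_integral K f \<ge> norm (cross3 (p - r) (q - r)) * ((f p + f q + f r) / 576)"
proof -
  obtain p' q' r' where perm: "{p', q', r'} = {p, q, r}"
    and *: "triangle_integral K f = norm (cross3 (p - r) (q - r)) *
       integral ref_triangle (\<lambda>(s, t). f (p' + s *\<^sub>R (q' - p') + t *\<^sub>R (r' - p')))"
    using triangle_integral_enum[OF K] by metis
  have K': "K = convex hull {p', q', r'}" using K perm by simp
  have nc': "\<not> collinear {p', q', r'}" using K perm by simp
  have in_K: "p' \<in> K" "q' \<in> K" "r' \<in> K"
    unfolding K' by (auto intro: hull_inc)
  have nonneg': "f p' \<ge> 0" "f q' \<ge> 0" "f r' \<ge> 0"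
    using perm nonneg by (metis insert_iff empty_iff)+
  have dist: "p \<noteq> q" "q \<noteq> r" "p \<noteq> r" "p' \<noteq> q'" "q' \<noteq> r'" "p' \<noteq> r'"
    using K(2) nc' by (auto simp: collinear_3_eq_affine_dependent)
  have sum: "f p' + f q' + f r' = f p + f q + f r"
    using arg_cong[OF perm, of "sum f"] dist by (simp add: algebra_simps)
  define F where "F = (\<lambda>z :: real \<times> real. (1 - fst z - snd z) * f p' + fst z * f q' + snd z * f r')"
  have F: "f (p' + s *\<^sub>R (q' - p') + t *\<^sub>R (r' - p')) = F (s, t)" if "(s, t) \<in> ref_triangle" for s t
  proof -
    have "p' + s *\<^sub>R (q' - p') + t *\<^sub>R (r' - p') \<in> K"
      using affine_par_in_triangle[OF that] K' by simp
    from f[OF this] show ?thesis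
      by (simp add: F_def f in_K algebra_simps)
  qed
  define B :: "(real \<times> real) set" where "B = cbox (1/4, 1/4) (1/3, 1/3)"
  have B: "1/4 \<le> fst z" "fst z \<le> 1/3" "1/4 \<le> snd z" "snd z \<le> 1/3" if "z \<in> B" for z
    using that by (auto simp: B_def cbox_Pair_eq)
  have contF: "continuous_on S F" for S
    unfolding F_def by (intro continuous_intros)
  have int_T: "F integrable_on ref_triangle"
    using borel_integrable_compact[OF compact_ref_triangle contF]
    by (intro set_borel_integral_eq_integral(1)) (simp add: set_integrable_def)
  have int_B: "F integrable_on B"
    unfolding B_def by (rule integrable_continuous[OF contF])
  have "z \<in> ref_triangle" if "z \<in> B" for z
    unfolding ref_triangle_def case_prod_beta mem_Collect_eq using B[OF that] by linarith
  then have "B \<subseteq> ref_triangle"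
    by blast
  moreover have "\<forall>z\<in>ref_triangle. 0 \<le> F z"
    using nonneg' by (auto simp: F_def ref_triangle_def)
  ultimately have "integral B F \<le> integral ref_triangle F"
    using integral_subset_le int_B int_T by blast
  moreover have "integral B (\<lambda>_. (f p + f q + f r) / 4) \<le> integral B F"
  proof (rule integral_le)
    show "(f p + f q + f r) / 4 \<le> F z" if "z \<in> B" for z
    proof -
      have "1/4 * f p' \<le> (1 - fst z - snd z) * f p'" "1/4 * f q' \<le> fst z * f q'"
           "1/4 * f r' \<le> snd z * f r'"
        using B[OF that] nonneg' by (intro mult_right_mono; linarith)+
      then have "1/4 * f p' + 1/4 * f q' + 1/4 * f r' \<le> F z"
        unfolding F_def by (intro add_mono)
      then show ?thesis by (simp add: sum[symmetric])
    qed
  qed (use int_B in \<open>auto simp: B_def\<close>)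
  moreover have "integral B (\<lambda>_. (f p + f q + f r) / 4) = (f p + f q + f r) / 576"
    unfolding B_def by (simp add: content_Pair)
  ultimately have "(f p + f q + f r) / 576 \<le> integral ref_triangle F"
    by simp
  moreover have "integral ref_triangle (\<lambda>(s, t). f (p' + s *\<^sub>R (q' - p') + t *\<^sub>R (r' - p')))
      = integral ref_triangle F"
    by (rule integral_cong) (use F in auto)
  ultimately show ?thesis
    unfolding * by (intro mult_left_mono) simp_all
qed

section \<open>Gradients of affine functions on a triangle\<close>

lemma cross3_nonzero:
  assumes "\<not> collinear {p, q, r}"
  shows "cross3 (p - r) (q - r) \<noteq> 0"
  using assms by (simp add: cross_eq_0 collinear_3[of p r q, symmetric] insert_commute)

text \<open>The gradient of the barycentric coordinate of \<open>p\<close> in the triangle \<open>p q r\<close>: it is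
  tangent to the triangle, orthogonal to the edge \<open>q - r\<close>, and normalised by the Gram determinant of
  \<open>p - r\<close> and \<open>q - r\<close>, which is \<open>|(p - r) \<times> (q - r)|\<^sup>2\<close>.  Exchanging \<open>p\<close> and \<open>q\<close> gives the gradient for \<open>q\<close>.\<close>

definition hat_gradient :: "real^3 \<Rightarrow> real^3 \<Rightarrow> real^3 \<Rightarrow> real^3" where
  "hat_gradient p q r = (1 / (norm (cross3 (p - r) (q - r)))\<^sup>2) *\<^sub>R
     (((q - r) \<bullet> (q - r)) *\<^sub>R (p - r) - ((p - r) \<bullet> (q - r)) *\<^sub>R (q - r))"

lemma hat_gradient_span: "hat_gradient p q r \<in> span {p - r, q - r}"
  unfolding hat_gradient_def by (intro span_scale span_diff span_base) auto

lemma hat_gradient_inner: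
  assumes "\<not> collinear {p, q, r}"
  shows "hat_gradient p q r \<bullet> (p - r) = 1" "hat_gradient p q r \<bullet> (q - r) = 0"
proof -
  have nz: "(norm (cross3 (p - r) (q - r)))\<^sup>2 \<noteq> 0"
    using cross3_nonzero[OF assms] by simp
  have eq: "(norm (cross3 (p - r) (q - r)))\<^sup>2 =
      ((p - r) \<bullet> (p - r)) * ((q - r) \<bullet> (q - r)) - ((p - r) \<bullet> (q - r)) * ((p - r) \<bullet> (q - r))"
    unfolding power2_norm_eq_inner dot_cross inner_commute[of "q - r" "p - r"] by simp
  show "hat_gradient p q r \<bullet> (p - r) = 1"
    unfolding hat_gradient_def inner_scaleR_left inner_diff_left[of "_ *\<^sub>R _"]
    using nz by (simp only: eq inner_commute[of "q - r" "p - r"]) (simp add: mult.commute)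
  show "hat_gradient p q r \<bullet> (q - r) = 0"
    unfolding hat_gradient_def inner_scaleR_left inner_diff_left[of "_ *\<^sub>R _"] by simp
qed

lemma hat_gradients_inner:
  assumes "\<not> collinear {p, q, r}"
  shows "hat_gradient p q r \<bullet> hat_gradient q p r =
    - ((p - r) \<bullet> (q - r)) / (norm (cross3 (p - r) (q - r)))\<^sup>2"
proof -
  have nc: "\<not> collinear {q, p, r}"
    using assms by (simp add: insert_commute)
  have "hat_gradient p q r \<bullet> hat_gradient q p r =
    (1 / (norm (cross3 (p - r) (q - r)))\<^sup>2) * (((q - r) \<bullet> (q - r)) * ((p - r) \<bullet> hat_gradient q p r)
      - ((p - r) \<bullet> (q - r)) * ((q - r) \<bullet> hat_gradient q p r))"
    by (simp only: hat_gradient_def[of p q r] inner_scaleR_left inner_diff_left[of "_ *\<^sub>R _"])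
  then show ?thesis
    using hat_gradient_inner[OF nc] by (simp add: inner_commute)
qed

text \<open>A derivative within \<open>K\<close> is unique only along directions into \<open>K\<close>.  The segments from \<open>y\<close> to
  the points of \<open>K\<close> stay in the convex set \<open>K\<close> and determine \<open>(z - y) \<bullet> g\<close> for all \<open>z \<in> K\<close>, also when
  \<open>y\<close> is a boundary point; since \<open>g\<close> is tangent to \<open>K\<close>, this fixes \<open>g\<close>.\<close>

lemma tangential_gradient_eqI:
  assumes K: "K = convex hull {p, q, r}" and y: "y \<in> K"
    and f: "\<And>z. z \<in> K \<Longrightarrow> f z = g0 \<bullet> z + c"
    and g: "g \<in> span {p - r, q - r}" "g \<bullet> (p - r) = f p - f r" "g \<bullet> (q - r) = f q - f r"
  shows "tangential_gradient K f y = g"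
proof -
  have in_K: "p \<in> K" "q \<in> K" "r \<in> K"
    unfolding K by (auto intro: hull_inc)
  \<comment> \<open>\<open>g0\<close> may have a component normal to the triangle; \<open>g\<close> is its tangential part.\<close>
  have const: "(g0 - g) \<bullet> z = (g0 - g) \<bullet> r" if z: "z \<in> K" for z
  proof -
    obtain a b where "z = r + a *\<^sub>R (p - r) + b *\<^sub>R (q - r)"
      using z convex_hull_3_alt[of r p q] unfolding K by (auto simp: insert_commute)
    moreover have "(g0 - g) \<bullet> (p - r) = 0" "(g0 - g) \<bullet> (q - r) = 0"
      using g(2,3) f in_K by (simp_all add: inner_diff_left inner_diff_right)
    ultimately show ?thesis
      by (simp add: inner_add_right)
  qed
  have f_eq: "f z = f y + (z - y) \<bullet> g" if z: "z \<in> K" for z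
  proof -
    have "g0 \<bullet> z - g \<bullet> z = g0 \<bullet> y - g \<bullet> y"
      using const[OF z] const[OF y] by (simp add: inner_diff_left)
    moreover have "(z - y) \<bullet> g = g \<bullet> z - g \<bullet> y"
      by (simp add: inner_diff_right inner_commute[of "z - y" g])
    ultimately show ?thesis
      using f[OF z] f[OF y] by simp
  qed
  let ?S = "span ((\<lambda>z. z - y) ` K)"
  have edge: "u - r \<in> ?S" if "u \<in> K" for u
  proof -
    have "(u - y) - (r - y) \<in> ?S"
      using that in_K(3) by (intro span_diff span_base) auto
    then show ?thesis by simp
  qed
  have "span {p - r, q - r} \<subseteq> ?S"
    by (rule span_minimal) (use edge in_K in auto)
  then have g_S: "g \<in> ?S"
    using g(1) by blast
  have der: "(f has_derivative (\<lambda>v. v \<bullet> g)) (at y within K)"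
  proof (rule has_derivative_transform[OF y])
    show "((\<lambda>z. f y + (z - y) \<bullet> g) has_derivative (\<lambda>v. v \<bullet> g)) (at y within K)"
      by (auto intro!: derivative_eq_intros)
  qed (rule f_eq)
  have unique: "g' = g"
    if g'_S: "g' \<in> ?S" and der': "(f has_derivative (\<lambda>v. v \<bullet> g')) (at y within K)" for g'
  proof -
    have dir: "(z - y) \<bullet> (g' - g) = 0" if z: "z \<in> K" for z
    proof -
      define \<gamma> where "\<gamma> t = y + t *\<^sub>R (z - y)" for t :: real
      have "convex K" unfolding K by simp
      have \<gamma>_K: "\<gamma> ` {0..1} \<subseteq> K"
      proof
        fix w assume "w \<in> \<gamma> ` {0..1}"
        then obtain t where t: "0 \<le> t" "t \<le> 1" "w = \<gamma> t" by auto
        have "(1 - t) *\<^sub>R y + t *\<^sub>R z \<in> K"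
          using convexD[OF \<open>convex K\<close> y z, of "1 - t" t] t by simp
        moreover have "w = (1 - t) *\<^sub>R y + t *\<^sub>R z"
          using t by (simp add: \<gamma>_def algebra_simps)
        ultimately show "w \<in> K" by simp
      qed
      have \<gamma>_der: "(\<gamma> has_derivative (\<lambda>t. t *\<^sub>R (z - y))) (at 0 within {0..1})"
        unfolding \<gamma>_def by (auto intro!: derivative_eq_intros)
      have path: "((f \<circ> \<gamma>) has_vector_derivative ((z - y) \<bullet> g'')) (at 0 within {0..1})"
        if "(f has_derivative (\<lambda>v. v \<bullet> g'')) (at y within K)" for g''
      proof -
        have "(f has_derivative (\<lambda>v. v \<bullet> g'')) (at (\<gamma> 0) within \<gamma> ` {0..1})"
          using has_derivative_subset[OF that \<gamma>_K] by (simp add: \<gamma>_def)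
        from diff_chain_within[OF \<gamma>_der this] show ?thesis
          by (simp add: has_vector_derivative_def o_def)
      qed
      have "at 0 within {0..1} \<noteq> (bot :: real filter)"
        by (simp add: at_within_Icc_at_right)
      from vector_derivative_unique_within[OF this path[OF der'] path[OF der]] show ?thesis
        by (simp add: inner_diff_right)
    qed
    have "orthogonal (g' - g) v" if "v \<in> ?S" for v
      by (rule orthogonal_to_span[OF that]) (use dir in \<open>auto simp: orthogonal_def inner_commute\<close>)
    then have "orthogonal (g' - g) (g' - g)"
      using g_S g'_S by (simp add: span_diff)
    then show ?thesis by (simp add: orthogonal_def)
  qed
  show ?thesis
    unfolding tangential_gradient_def using der g_S unique by (intro the_equality) blast+
qed

text \<open>Depends linearly on \<open>f\<close>, and only on its corner values; both are used for the row sums of the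
  stiffness matrix.\<close>

definition affine_gradient :: "real^3 \<Rightarrow> real^3 \<Rightarrow> real^3 \<Rightarrow> (real^3 \<Rightarrow> real) \<Rightarrow> real^3" where
  "affine_gradient p q r f =
     (f p - f r) *\<^sub>R hat_gradient p q r + (f q - f r) *\<^sub>R hat_gradient q p r"

lemma tangential_gradient_affine:
  assumes K: "K = convex hull {p, q, r}" and nc: "\<not> collinear {p, q, r}" and y: "y \<in> K"
    and f: "\<And>z. z \<in> K \<Longrightarrow> f z = g0 \<bullet> z + c"
  shows "tangential_gradient K f y = affine_gradient p q r f"
proof (rule tangential_gradient_eqI[OF K y f])
  have nc': "\<not> collinear {q, p, r}"
    using nc by (simp add: insert_commute)
  show "affine_gradient p q r f \<in> span {p - r, q - r}"
    unfolding affine_gradient_def using hat_gradient_span[of p q r] hat_gradient_span[of q p r]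
    by (intro span_add span_scale) (simp_all add: insert_commute)
  show "affine_gradient p q r f \<bullet> (p - r) = f p - f r"
    "affine_gradient p q r f \<bullet> (q - r) = f q - f r"
    unfolding affine_gradient_def inner_add_left inner_scaleR_left
    by (simp_all only: hat_gradient_inner[OF nc] hat_gradient_inner[OF nc']) simp_all
qed assumption

lemma triangle_integral_gradients:
  assumes K: "K = convex hull {p, q, r}" and nc: "\<not> collinear {p, q, r}"
    and f: "\<And>z. z \<in> K \<Longrightarrow> f z = g \<bullet> z + c" and f': "\<And>z. z \<in> K \<Longrightarrow> f' z = g' \<bullet> z + c'"
  shows "triangle_integral K (\<lambda>y. tangential_gradient K f y \<bullet> tangential_gradient K f' y) =
    (affine_gradient p q r f \<bullet> affine_gradient p q r f') *
      norm (cross3 (p - r) (q - r)) * integral ref_triangle (\<lambda>_. 1)"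
  by (rule triangle_integral_const[OF K nc])
     (simp only: tangential_gradient_affine[OF K nc _ f] tangential_gradient_affine[OF K nc _ f'])

lemma angle_at_range: "0 \<le> angle_at r p q" "angle_at r p q \<le> pi"
  and cos_angle_at: "cos (angle_at r p q) = ((p - r) \<bullet> (q - r)) / (norm (p - r) * norm (q - r))"
proof -
  have "\<bar>((p - r) \<bullet> (q - r)) / (norm (p - r) * norm (q - r))\<bar> \<le> 1"
    using Cauchy_Schwarz_ineq2[of "p - r" "q - r"] by (auto simp: divide_le_eq_1 zero_less_mult_iff abs_mult)
  then have "-1 \<le> ((p - r) \<bullet> (q - r)) / (norm (p - r) * norm (q - r))"
    "((p - r) \<bullet> (q - r)) / (norm (p - r) * norm (q - r)) \<le> 1"
    by linarith+
  then show "0 \<le> angle_at r p q" "angle_at r p q \<le> pi"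
    "cos (angle_at r p q) = ((p - r) \<bullet> (q - r)) / (norm (p - r) * norm (q - r))"
    unfolding angle_at_def by (simp_all add: arccos_lbound arccos_ubound)
qed

lemma sin_angle_at:
  assumes "p \<noteq> r" "q \<noteq> r"
  shows "sin (angle_at r p q) = norm (cross3 (p - r) (q - r)) / (norm (p - r) * norm (q - r))"
proof (rule power2_eq_imp_eq)
  have nz: "norm (p - r) * norm (q - r) \<noteq> 0"
    using assms by simp
  have "(sin (angle_at r p q))\<^sup>2 = 1 - (((p - r) \<bullet> (q - r)) / (norm (p - r) * norm (q - r)))\<^sup>2"
    by (simp only: sin_squared_eq cos_angle_at)
  also have "\<dots> = ((norm (p - r) * norm (q - r))\<^sup>2 - ((p - r) \<bullet> (q - r))\<^sup>2) / (norm (p - r) * norm (q - r))\<^sup>2"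
    using nz by (simp add: power_divide diff_divide_distrib)
  also have "\<dots> = (norm (cross3 (p - r) (q - r)) / (norm (p - r) * norm (q - r)))\<^sup>2"
    by (simp only: norm_cross power_divide power_mult_distrib)
  finally show "(sin (angle_at r p q))\<^sup>2 = (norm (cross3 (p - r) (q - r)) / (norm (p - r) * norm (q - r)))\<^sup>2" .
  show "0 \<le> sin (angle_at r p q)"
    using angle_at_range by (simp add: sin_ge_zero)
qed simp

text \<open>The inner product of the two gradients is \<open>- (u \<bullet> v) / |u \<times> v|\<^sup>2\<close> with \<open>u = p - r\<close> and
  \<open>v = q - r\<close>.  Multiplied by \<open>|u \<times> v|\<close> it becomes \<open>- (u \<bullet> v) / |u \<times> v|\<close>, the negative quotient of
  \<open>|u| |v| cos \<theta>\<close> and \<open>|u| |v| sin \<theta>\<close> for the angle \<open>\<theta>\<close> at \<open>r\<close>.\<close>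

lemma hat_gradients_cot:
  assumes "\<not> collinear {p, q, r}"
  shows "(hat_gradient p q r \<bullet> hat_gradient q p r) * norm (cross3 (p - r) (q - r)) =
    - cot (angle_at r p q)"
proof -
  have "p \<noteq> r" "q \<noteq> r"
    using assms by (auto simp: collinear_3_eq_affine_dependent)
  moreover have "norm (cross3 (p - r) (q - r)) \<noteq> 0"
    using cross3_nonzero[OF assms] by simp
  ultimately show ?thesis
    unfolding hat_gradients_inner[OF assms] cot_def cos_angle_at
    by (simp add: sin_angle_at power2_eq_square)
qed

text \<open>The sum of the cotangents is the sine of the sum of the angles divided by the product of
  their sines, and the angles of a nondegenerate triangle have positive sine.\<close>

lemma cot_angles_nonneg:
  assumes nc: "\<not> collinear {p, q, r}" "\<not> collinear {p, q, s}"
    and sum: "angle_at r p q + angle_at s p q \<le> pi"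
  shows "cot (angle_at r p q) + cot (angle_at s p q) \<ge> 0"
proof -
  have pos: "sin (angle_at t p q) > 0" if "\<not> collinear {p, q, t}" for t
  proof -
    have "p \<noteq> t" "q \<noteq> t"
      using that by (auto simp: collinear_3_eq_affine_dependent)
    then show ?thesis
      using cross3_nonzero[OF that] by (simp add: sin_angle_at)
  qed
  have "sin (angle_at r p q + angle_at s p q) \<ge> 0"
    using sum angle_at_range(1) by (intro sin_ge_zero) auto
  then have "(sin (angle_at r p q) * cos (angle_at s p q) + cos (angle_at r p q) * sin (angle_at s p q))
    / (sin (angle_at r p q) * sin (angle_at s p q)) \<ge> 0"
    using pos[OF nc(1)] pos[OF nc(2)] by (simp add: sin_add)
  then show ?thesis
    using pos[OF nc(1)] pos[OF nc(2)] by (simp add: cot_def add_divide_distrib add.commute)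
qed

section \<open>Mass and stiffness matrices of a triangulated surface\<close>

locale nodal_mesh =
  fixes \<K> :: "(real^3) set set" and x :: "'n::finite \<Rightarrow> real^3" and \<phi> :: "'n \<Rightarrow> real^3 \<Rightarrow> real"
  assumes triangulated: "closed_triangulated_surface \<K>"
    and nodes: "bij_betw x UNIV (vertices \<K>)"
    and basis: "nodal_basis \<K> x \<phi>"
begin

lemma finite_mesh: "finite \<K>"
  using triangulated by (simp add: closed_triangulated_surface_def triangulation_def)

lemma simplex_mesh: "K \<in> \<K> \<Longrightarrow> 2 simplex K"
  using triangulated by (simp add: closed_triangulated_surface_def)

lemma edge_in_two_triangles:
  "convex hull {p, q, r} \<in> \<K> \<Longrightarrow> card {K \<in> \<K>. \<exists>s. K = convex hull {p, q, s}} = 2"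
  using triangulated unfolding closed_triangulated_surface_def by blast

lemma basis_nodes: "\<phi> i (x j) = (if i = j then 1 else 0)"
  using basis by (simp add: nodal_basis_def)

lemma basis_continuous: "continuous_on (\<Union>\<K>) (\<phi> i)"
  using basis by (simp add: nodal_basis_def fe_space_def)

lemma basis_affine:
  assumes "K \<in> \<K>"
  obtains g c where "\<And>y. y \<in> K \<Longrightarrow> \<phi> i y = g \<bullet> y + c"
proof -
  have "\<phi> i \<in> fe_space \<K>"
    using basis by (simp add: nodal_basis_def)
  then have "\<exists>g c. \<forall>y\<in>K. \<phi> i y = g \<bullet> y + c"
    using assms unfolding fe_space_def by blast
  then show thesis
    using that by blast
qed

lemma triangle_corners_are_nodes:
  assumes "K \<in> \<K>" "K = convex hull {p, q, r}"
  obtains a b c where "p = x a" "q = x b" "r = x c"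
proof -
  have nc: "\<not> collinear {p, q, r}"
    using simplex_mesh assms not_collinear_simplex2 by blast
  have "{p, q, r} \<subseteq> vertices \<K>"
    using extreme_points_triangle[OF nc] assms unfolding vertices_def by blast
  also have "\<dots> = range x"
    using nodes by (simp add: bij_betw_def)
  finally have "p \<in> range x" "q \<in> range x" "r \<in> range x"
    by simp_all
  then show thesis
    by (elim rangeE) (rule that)
qed

lemma mesh_triangle_obtain:
  assumes "K \<in> \<K>"
  obtains a b c where "K = convex hull {x a, x b, x c}" "\<not> collinear {x a, x b, x c}"
proof -
  obtain p q r where pqr: "K = convex hull {p, q, r}" "\<not> collinear {p, q, r}"
    by (rule simplex2_obtain[OF simplex_mesh[OF assms]])
  obtain a b c where "p = x a" "q = x b" "r = x c"
    by (rule triangle_corners_are_nodes[OF assms pqr(1)])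
  with pqr show thesis
    by (intro that[of a b c]) simp_all
qed

text \<open>At every node at least one of two different hat functions vanishes.\<close>

lemma interpolant_basis_product:
  "interpolant x \<phi> (\<lambda>y. \<phi> i y * \<phi> j y) = (if i = j then \<phi> i else (\<lambda>_. 0))"
proof
  fix y
  have "interpolant x \<phi> (\<lambda>y. \<phi> i y * \<phi> j y) y =
    (\<Sum>k\<in>UNIV. if k = i then (if i = j then \<phi> i y else 0) else 0)"
    unfolding interpolant_def by (rule sum.cong) (auto simp: basis_nodes)
  then show "interpolant x \<phi> (\<lambda>y. \<phi> i y * \<phi> j y) y = (if i = j then \<phi> i else (\<lambda>_. 0)) y"
    by simp
qed

lemma lumped_mass_offdiag:
  assumes "i \<noteq> j"
  shows "lumped_mass_matrix \<K> x \<phi> $ i $ j = 0"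
proof -
  have "triangle_integral K (\<lambda>_. 0) = 0" if K: "K \<in> \<K>" for K
  proof -
    obtain a b c where "K = convex hull {x a, x b, x c}" "\<not> collinear {x a, x b, x c}"
      by (rule mesh_triangle_obtain[OF K]) (rule that)
    from triangle_integral_const[OF this, of "\<lambda>_. 0" 0] show ?thesis
      by simp
  qed
  then show ?thesis
    using assms by (simp add: lumped_mass_matrix_def interpolant_basis_product)
qed

lemma basis_integral_nonneg:
  assumes "K \<in> \<K>"
  shows "triangle_integral K (\<phi> i) \<ge> 0"
    and "x i extreme_point_of K \<Longrightarrow> triangle_integral K (\<phi> i) > 0"
proof -
  obtain a b c where K: "K = convex hull {x a, x b, x c}" "\<not> collinear {x a, x b, x c}"
    by (rule mesh_triangle_obtain[OF assms]) (rule that)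
  obtain g d where "\<And>y. y \<in> K \<Longrightarrow> \<phi> i y = g \<bullet> y + d"
    by (rule basis_affine[OF assms]) (rule that)
  from triangle_integral_affine_ge[OF K this]
  have ge: "norm (cross3 (x a - x c) (x b - x c)) * ((\<phi> i (x a) + \<phi> i (x b) + \<phi> i (x c)) / 576)
      \<le> triangle_integral K (\<phi> i)"
    by (simp add: basis_nodes)
  have sum_nonneg: "0 \<le> \<phi> i (x a) + \<phi> i (x b) + \<phi> i (x c)"
    by (simp add: basis_nodes)
  then have "0 \<le> norm (cross3 (x a - x c) (x b - x c)) * ((\<phi> i (x a) + \<phi> i (x b) + \<phi> i (x c)) / 576)"
    by (intro mult_nonneg_nonneg) auto
  then show "triangle_integral K (\<phi> i) \<ge> 0"
    using ge by linarith
  show "triangle_integral K (\<phi> i) > 0" if "x i extreme_point_of K"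
  proof -
    have "x i \<in> {x a, x b, x c}"
      using that extreme_points_triangle[OF K(2)] K(1) by blast
    then obtain k where "k \<in> {a, b, c}" "x i = x k"
      by blast
    then have "k \<in> {a, b, c}" "i = k"
      using nodes by (auto simp: bij_betw_def dest: injD)
    then have "0 < \<phi> i (x a) + \<phi> i (x b) + \<phi> i (x c)"
      by (auto simp: basis_nodes)
    then have "0 < norm (cross3 (x a - x c) (x b - x c)) * ((\<phi> i (x a) + \<phi> i (x b) + \<phi> i (x c)) / 576)"
      using cross3_nonzero[OF K(2)] by (intro mult_pos_pos) auto
    then show ?thesis
      using ge by linarith
  qed
qed

lemma lumped_mass_diag_pos: "lumped_mass_matrix \<K> x \<phi> $ i $ i > 0"
proof -
  have "x i \<in> vertices \<K>"
    using nodes by (auto simp: bij_betw_def)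
  then obtain K where "K \<in> \<K>" "x i extreme_point_of K"
    by (auto simp: vertices_def)
  then have "(\<Sum>K\<in>\<K>. triangle_integral K (\<phi> i)) > 0"
    using basis_integral_nonneg finite_mesh by (intro sum_pos2[of \<K> K]) auto
  then show ?thesis
    by (simp add: lumped_mass_matrix_def interpolant_basis_product)
qed

lemma basis_gradient_integral:
  assumes "K \<in> \<K>" "K = convex hull {p, q, r}"
  shows "triangle_integral K (\<lambda>y. tangential_gradient K (\<phi> i) y \<bullet> tangential_gradient K (\<phi> j) y) =
    (affine_gradient p q r (\<phi> i) \<bullet> affine_gradient p q r (\<phi> j)) *
      norm (cross3 (p - r) (q - r)) * integral ref_triangle (\<lambda>_. 1)"
proof -
  obtain g c where i: "\<And>y. y \<in> K \<Longrightarrow> \<phi> i y = g \<bullet> y + c"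
    by (rule basis_affine[OF assms(1)]) (rule that)
  obtain g' c' where j: "\<And>y. y \<in> K \<Longrightarrow> \<phi> j y = g' \<bullet> y + c'"
    by (rule basis_affine[OF assms(1)]) (rule that)
  have "\<not> collinear {p, q, r}"
    using simplex_mesh assms not_collinear_simplex2 by blast
  from triangle_integral_gradients[OF assms(2) this i j] show ?thesis .
qed

text \<open>On each triangle the hat functions sum to 1 at all three corners, so the gradient of their
  sum vanishes.\<close>

lemma stiffness_row_sum: "(\<Sum>j\<in>UNIV. stiffness_matrix \<K> \<phi> $ i $ j) = 0"
proof -
  have "(\<Sum>j\<in>UNIV. triangle_integral K
      (\<lambda>y. tangential_gradient K (\<phi> i) y \<bullet> tangential_gradient K (\<phi> j) y)) = 0" if K: "K \<in> \<K>" for K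
  proof -
    obtain a b c where abc: "K = convex hull {x a, x b, x c}"
      by (rule mesh_triangle_obtain[OF K]) (rule that)
    have one: "(\<Sum>j\<in>UNIV. \<phi> j (x k)) = 1" for k
      by (simp add: basis_nodes)
    have "(\<Sum>j\<in>UNIV. affine_gradient (x a) (x b) (x c) (\<phi> j)) = 0"
      unfolding affine_gradient_def sum.distrib scaleR_sum_left[symmetric] sum_subtractf one by simp
    then have "affine_gradient (x a) (x b) (x c) (\<phi> i) \<bullet>
        (\<Sum>j\<in>UNIV. affine_gradient (x a) (x b) (x c) (\<phi> j)) = 0"
      by (simp only: inner_zero_right)
    then show ?thesis
      by (simp only: basis_gradient_integral[OF K abc] sum_distrib_right[symmetric]
        inner_sum_right[symmetric] mult_zero_left)
  qed
  then have "(\<Sum>K\<in>\<K>. \<Sum>j\<in>UNIV. triangle_integral K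
      (\<lambda>y. tangential_gradient K (\<phi> i) y \<bullet> tangential_gradient K (\<phi> j) y)) = 0"
    by simp
  then show ?thesis
    unfolding stiffness_matrix_def vec_lambda_beta by (subst sum.swap)
qed

text \<open>On a triangle with the edge \<open>x\<^sub>i x\<^sub>j\<close> the functions \<open>\<phi>\<^sub>i\<close> and \<open>\<phi>\<^sub>j\<close> are the barycentric
  coordinates of \<open>x\<^sub>i\<close> and \<open>x\<^sub>j\<close>, because the third corner is another node.\<close>

lemma edge_gradient_integral:
  assumes K: "K \<in> \<K>" "K = convex hull {x i, x j, r}"
  shows "triangle_integral K (\<lambda>y. tangential_gradient K (\<phi> i) y \<bullet> tangential_gradient K (\<phi> j) y) =
    - cot (angle_at r (x i) (x j)) * integral ref_triangle (\<lambda>_. 1)"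
proof -
  have nc: "\<not> collinear {x i, x j, r}"
    using simplex_mesh K not_collinear_simplex2 by blast
  obtain k where k: "r = x k"
    by (rule triangle_corners_are_nodes[OF K]) (rule that)
  have "k \<noteq> i" "k \<noteq> j" "i \<noteq> j"
    using nc k by (auto simp: collinear_3_eq_affine_dependent)
  then have "affine_gradient (x i) (x j) r (\<phi> i) = hat_gradient (x i) (x j) r"
    "affine_gradient (x i) (x j) r (\<phi> j) = hat_gradient (x j) (x i) r"
    by (simp_all add: affine_gradient_def k basis_nodes)
  then show ?thesis
    by (simp only: basis_gradient_integral[OF K] hat_gradients_cot[OF nc])
qed

text \<open>One of the nodes \<open>x\<^sub>i\<close>, \<open>x\<^sub>j\<close> is not a corner of \<open>K\<close>, so its hat function vanishes at all
  corners and is constant zero on \<open>K\<close>.\<close>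

lemma no_edge_gradient_integral:
  assumes K: "K \<in> \<K>" and no_edge: "\<nexists>s. K = convex hull {x i, x j, s}" and "i \<noteq> j"
  shows "triangle_integral K (\<lambda>y. tangential_gradient K (\<phi> i) y \<bullet> tangential_gradient K (\<phi> j) y) = 0"
proof -
  obtain a b c where abc: "K = convex hull {x a, x b, x c}"
    by (rule mesh_triangle_obtain[OF K]) (rule that)
  have "i \<notin> {a, b, c} \<or> j \<notin> {a, b, c}"
  proof (rule ccontr)
    assume "\<not> ?thesis"
    then have "\<exists>k. {x a, x b, x c} = {x i, x j, x k}"
      using \<open>i \<noteq> j\<close> by (auto simp: insert_commute)
    then show False
      using no_edge abc by metis
  qed
  then have "affine_gradient (x a) (x b) (x c) (\<phi> i) = 0 \<or> affine_gradient (x a) (x b) (x c) (\<phi> j) = 0"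
    by (auto simp: affine_gradient_def basis_nodes)
  then show ?thesis
    unfolding basis_gradient_integral[OF K abc] by auto
qed

text \<open>Only the triangles with the edge \<open>x\<^sub>i x\<^sub>j\<close> contribute.  If there is one, there are exactly
  two, and the angle condition applies to this pair.\<close>

lemma stiffness_offdiag:
  assumes angles: "angle_condition \<K>" and "i \<noteq> j"
  shows "stiffness_matrix \<K> \<phi> $ i $ j \<le> 0"
proof -
  define I where "I K = triangle_integral K
    (\<lambda>y. tangential_gradient K (\<phi> i) y \<bullet> tangential_gradient K (\<phi> j) y)" for K
  define E where "E = {K \<in> \<K>. \<exists>s. K = convex hull {x i, x j, s}}"
  have "stiffness_matrix \<K> \<phi> $ i $ j = sum I \<K>"
    by (simp add: stiffness_matrix_def I_def)
  also have "\<dots> = sum I E"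
  proof (rule sum.mono_neutral_right[OF finite_mesh])
    show "\<forall>K\<in>\<K> - E. I K = 0"
    proof
      fix K assume "K \<in> \<K> - E"
      then have "K \<in> \<K>" "\<nexists>s. K = convex hull {x i, x j, s}"
        by (simp_all add: E_def)
      then show "I K = 0"
        unfolding I_def using \<open>i \<noteq> j\<close> by (rule no_edge_gradient_integral)
    qed
  qed (simp add: E_def)
  also have "\<dots> \<le> 0"
  proof (cases "E = {}")
    case False
    then obtain s where "convex hull {x i, x j, s} \<in> \<K>"
      unfolding E_def by blast
    then have "card E = 2"
      unfolding E_def by (rule edge_in_two_triangles)
    then obtain K1 K2 where E: "E = {K1, K2}" "K1 \<noteq> K2"
      by (meson card_2_iff)
    have "K1 \<in> E" "K2 \<in> E"
      by (simp_all add: E(1))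
    then obtain r s where K: "K1 \<in> \<K>" "K1 = convex hull {x i, x j, r}"
      "K2 \<in> \<K>" "K2 = convex hull {x i, x j, s}"
      unfolding E_def mem_Collect_eq by (elim conjE exE)
    have "angle_at r (x i) (x j) + angle_at s (x i) (x j) \<le> pi"
      by (rule angles[unfolded angle_condition_def, rule_format])
         (use K(1,3) E(2) in \<open>simp_all only: K(2,4) not_False_eq_True\<close>)
    moreover have "\<not> collinear {x i, x j, r}" "\<not> collinear {x i, x j, s}"
      using K(1,3) by (simp_all only: K(2,4) simplex_mesh not_collinear_simplex2 not_False_eq_True)
    ultimately have "0 \<le> cot (angle_at r (x i) (x j)) + cot (angle_at s (x i) (x j))"
      by (intro cot_angles_nonneg)
    then have "0 \<le> (cot (angle_at r (x i) (x j)) + cot (angle_at s (x i) (x j))) * integral ref_triangle (\<lambda>_. 1)"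
      using integral_ref_triangle_nonneg by (rule mult_nonneg_nonneg)
    moreover have "sum I E = I K1 + I K2"
      using E by simp
    moreover have "I K1 = - cot (angle_at r (x i) (x j)) * integral ref_triangle (\<lambda>_. 1)"
      "I K2 = - cot (angle_at s (x i) (x j)) * integral ref_triangle (\<lambda>_. 1)"
      unfolding I_def by (rule edge_gradient_integral[OF K(1,2)] edge_gradient_integral[OF K(3,4)])+
    ultimately show ?thesis
      by (simp add: distrib_right)
  qed simp
  finally show ?thesis .
qed

text \<open>The function on the right takes the value \<open>v\<^sub>j\<close> at \<open>x\<^sub>j\<close>, and its supremum is finite by
  compactness of the surface; for an unbounded function \<open>SUP\<close> would be an arbitrary number.\<close>

lemma coefficient_le_SUP:
  "v $ j \<le> (SUP y\<in>\<Union>\<K>. \<Sum>i\<in>UNIV. v $ i * \<phi> i y)"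
proof -
  let ?U = "\<lambda>y. \<Sum>i\<in>UNIV. v $ i * \<phi> i y"
  have "compact (\<Union>\<K>)"
  proof (rule compact_Union[OF finite_mesh])
    show "compact K" if K: "K \<in> \<K>" for K
    proof -
      obtain a b c where "K = convex hull {x a, x b, x c}"
        by (rule mesh_triangle_obtain[OF K]) (rule that)
      then show ?thesis
        by (simp add: finite_imp_compact_convex_hull)
    qed
  qed
  moreover have "continuous_on (\<Union>\<K>) ?U"
    by (intro continuous_intros basis_continuous)
  ultimately have "bdd_above (?U ` \<Union>\<K>)"
    by (intro bounded_imp_bdd_above compact_imp_bounded compact_continuous_image)
  moreover have "x j \<in> \<Union>\<K>"
  proof -
    have "x j \<in> vertices \<K>"
      using nodes by (auto simp: bij_betw_def)
    then show ?thesis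
      by (auto simp: vertices_def extreme_point_of_def)
  qed
  ultimately have "?U (x j) \<le> (SUP y\<in>\<Union>\<K>. ?U y)"
    by (rule cSUP_upper[rotated])
  moreover have "?U (x j) = v $ j"
    by (simp add: basis_nodes if_distrib cong: if_cong)
  ultimately show ?thesis
    by simp
qed

end

section \<open>Invariance of the interval of initial values\<close>

theorem theorem2:
  fixes \<Gamma> W :: "(real^3) set" and \<delta> :: "real^3 \<Rightarrow> real"
    and \<K> :: "(real^3) set set" and h :: real
    and x :: "'n::finite \<Rightarrow> real^3" and \<phi> :: "'n \<Rightarrow> real^3 \<Rightarrow> real"
    and d \<beta> \<alpha> \<tau> :: real
    and \<xi> :: "nat \<Rightarrow> real^'n"
    and M A :: "real^'n^'n" and U0 :: "real^3 \<Rightarrow> real"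
  assumes surface: "level_surface \<Gamma> W \<delta>"
    and triangulated: "closed_triangulated_surface \<K>"
    and h: "h > 0" "\<forall>K\<in>\<K>. diameter K \<le> h"
    and in_W: "\<Union>\<K> \<subseteq> W"
    and vertices: "bij_betw x UNIV (vertices \<K>)" "\<forall>i. x i \<in> \<Gamma>"
    and one_to_one: "bij_betw (surface_projection \<Gamma> \<delta>) (\<Union>\<K>) \<Gamma>"
    and basis: "nodal_basis \<K> x \<phi>"
    and M: "M = lumped_mass_matrix \<K> x \<phi>"
    and A: "A = stiffness_matrix \<K> \<phi>"
    and angles: "angle_condition \<K>"
    and params: "d > 0" "\<beta> \<ge> 0" "\<alpha> \<ge> 1" "\<tau> > 0"
    and scheme: "\<forall>n. \<xi> (Suc n) =
      matrix_inv (M + (d * \<tau>) *\<^sub>R A) *v (M *v (\<xi> n - (\<tau> * \<beta>) *\<^sub>R cpow (\<xi> n) \<alpha>))"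
    and initial: "\<forall>i. \<xi> 0 $ i \<ge> 0"
    and U0: "U0 = (\<lambda>y. \<Sum>i\<in>UNIV. \<xi> 0 $ i * \<phi> i y)"
  shows "(ereal (\<beta> * \<tau>) \<le> time_step_bound (SUP y\<in>\<Union>\<K>. U0 y) \<alpha> \<longrightarrow>
           (\<forall>n i. 0 \<le> \<xi> n $ i \<and> \<xi> n $ i \<le> Max (range (\<lambda>j. \<xi> 0 $ j)))) \<and>
         (\<beta> = 0 \<longrightarrow>
           (\<forall>n i. 0 \<le> \<xi> n $ i \<and> \<xi> n $ i \<le> Max (range (\<lambda>j. \<xi> 0 $ j))))"
proof -
  interpret nodal_mesh \<K> x \<phi>
    by unfold_locales (fact triangulated vertices(1) basis)+
  define m where "m = Max (range (\<lambda>j. \<xi> 0 $ j))"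
  have bounds: "\<forall>i. 0 \<le> \<xi> n $ i \<and> \<xi> n $ i \<le> m"
    if step: "m > 0 \<Longrightarrow> \<tau> * \<beta> * m powr (\<alpha> - 1) \<le> 1" for n
  proof (induction n)
    case 0
    then show ?case
      using initial by (auto simp: m_def)
  next
    case (Suc n)
    let ?u = "\<xi> n - (\<tau> * \<beta>) *\<^sub>R cpow (\<xi> n) \<alpha>"
    have \<xi>_n: "0 \<le> \<xi> n $ i" "\<xi> n $ i \<le> m" for i
      using Suc.IH by simp_all
    have "\<tau> * \<beta> \<ge> 0"
      using params by simp
    note react = reaction_step_bounds[OF \<xi>_n this params(3) step]
    have u: "0 \<le> ?u $ i" "?u $ i \<le> m" for i
      using react[of i] by (simp_all add: cpow_def)
    have "d * \<tau> \<ge> 0"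
      using params by simp
    note step_bounds = implicit_step_bounds[OF lumped_mass_offdiag lumped_mass_diag_pos
      stiffness_offdiag[OF angles] stiffness_row_sum this u]
    show ?case
      unfolding scheme[rule_format] M A using step_bounds by blast
  qed
  have "\<tau> * \<beta> * m powr (\<alpha> - 1) \<le> 1"
    if "ereal (\<beta> * \<tau>) \<le> time_step_bound (SUP y\<in>\<Union>\<K>. U0 y) \<alpha>" "m > 0"
  proof -
    have "m \<in> range (\<lambda>j. \<xi> 0 $ j)"
      unfolding m_def by (rule Max_in) auto
    then obtain j where "m = \<xi> 0 $ j"
      by (rule imageE)
    then have "m \<le> (SUP y\<in>\<Union>\<K>. U0 y)"
      unfolding U0 by (simp only: coefficient_le_SUP)
    from step_factor_le_1[OF that(2) this params(3) that(1)] show ?thesis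
      by (simp only: mult.commute[of \<tau>])
  qed
  moreover have "\<tau> * \<beta> * m powr (\<alpha> - 1) \<le> 1" if "\<beta> = 0"
    using that by simp
  ultimately show ?thesis
    unfolding m_def[symmetric] using bounds by blast
qed

end
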